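(* Let $\mathcal G=(G,\omega)$ be a filling of a finite pseudo-metric space $\mathcal M=(M,\rho)$, where $G$ is a tree whose vertices of degree $1$ and $2$ all belong to $M$, and let $\pi\in\mathcal O(G)$ be a tour of $G$. Then the tour $\pi$ is exact if and only if $\omega(G)=p(\mathcal M,\pi)$. Thus, if $\pi$ is an exact tour of $G$, then $\mathcal G$ is a minimal parametric filling, and $$\mathrm{mpf}(\mathcal M,G)=p(\mathcal M,\pi)=\max_{\sigma\in\mathcal O(G)}p(\mathcal M,\sigma).$$
   Context: In a pseudo-metric space the distance between distinct points may be $0$. A finite graph $G=(V,E)$ joins $M$ (has boundary $M$) if it is connected and $M\subset V$. For a weight function $\omega:E\to[0,\infty)$, $d_\omega(u,v)$ is the least weight (sum of $\omega$ over edges) of a path in $G$ joining $u$ and $v$, and $\omega(G)=\sum_{e\in E}\omega(e)$. The weighted graph $(G,\omega)$ is a filling of $\mathcal M=(M,\rho)$ of type $G$ if $G$ joins $M$ and $\rho(p,q)\le d_\omega(p,q)$ for all $p,q\in M$. $\mathrm{mpf}(\mathcal M,G)$ is the infimum of $\omega(G)$ over all fillings $(G,\omega)$ of $\mathcal M$ of the fixed type $G$; a minimal parametric filling is a filling $(G,\omega)$ with $\omega(G)=\mathrm{mpf}(\mathcal M,G)$. Let $G=(V,E)$ be a tree with boundary $M$. For $e\in E$, let $G_1,G_2$ be the connected components of $G$ with $e$ removed, and $\mathcal P_G(e)=\{M_1,M_2\}$, where $M_i$ is the set of points of $M$ lying in $G_i$. A cyclic order on $M$ is a cyclic permutation $\pi:M\to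 M$ (a single cycle through all of $M$). It is a tour of $G$ if for every $e\in E$ and each $M_i\in\mathcal P_G(e)$ there is a unique $p\in M_i$ with $\pi(p)\notin M_i$. $\mathcal O(G)$ is the set of all tours of $G$. A tour $\pi$ is exact (for the filling $(G,\omega)$) if $\rho(p,\pi(p))=d_\omega(p,\pi(p))$ for every $p\in M$. The half-perimeter of $\mathcal M$ with respect to a cyclic order $\pi$ is $p(\mathcal M,\pi)=\frac12\sum_{x\in M}\rho(x,\pi(x))$. *)

theory Defs
  imports Complex_Main "HOL-Combinatorics.Orbits"
begin

locale pseudo_metric_space =
  fixes M :: "'a set" and \<rho> :: "'a \<Rightarrow> 'a \<Rightarrow> real"
  assumes nonneg: "\<lbrakk>x \<in> M; y \<in> M\<rbrakk> \<Longrightarrow> 0 \<le> \<rho> x y"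
    and zero: "x \<in> M \<Longrightarrow> \<rho> x x = 0"
    and commute: "\<lbrakk>x \<in> M; y \<in> M\<rbrakk> \<Longrightarrow> \<rho> x y = \<rho> y x"
    and triangle: "\<lbrakk>x \<in> M; y \<in> M; z \<in> M\<rbrakk> \<Longrightarrow> \<rho> x z \<le> \<rho> x y + \<rho> y z"

record 'a ugraph =
  vertices :: "'a set"
  edges :: "'a set set"

definition finite_graph :: "'a ugraph \<Rightarrow> bool" where
  "finite_graph G \<longleftrightarrow> finite (vertices G) \<and> (\<forall>e \<in> edges G. e \<subseteq> vertices G \<and> card e = 2)"

definition degree :: "'a ugraph \<Rightarrow> 'a \<Rightarrow> nat" where
  "degree G v = card {e \<in> edges G. v \<in> e}"

(* Paths and cycles are given by their lists of pairwise distinct vertices. *)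

definition gpath :: "'a ugraph \<Rightarrow> 'a \<Rightarrow> 'a list \<Rightarrow> 'a \<Rightarrow> bool" where
  "gpath G u xs v \<longleftrightarrow> xs \<noteq> [] \<and> hd xs = u \<and> last xs = v \<and> distinct xs \<and> set xs \<subseteq> vertices G \<and>
     successively (\<lambda>a b. {a, b} \<in> edges G) xs"

definition gcycle :: "'a ugraph \<Rightarrow> 'a list \<Rightarrow> bool" where
  "gcycle G xs \<longleftrightarrow> length xs \<ge> 3 \<and> distinct xs \<and> set xs \<subseteq> vertices G \<and>
     successively (\<lambda>a b. {a, b} \<in> edges G) xs \<and> {last xs, hd xs} \<in> edges G"

definition connected_graph :: "'a ugraph \<Rightarrow> bool" where
  "connected_graph G \<longleftrightarrow> vertices G \<noteq> {} \<and>
     (\<forall>u \<in> vertices G. \<forall>v \<in> vertices G. \<exists>xs. gpath G u xs v)"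

definition tree_graph :: "'a ugraph \<Rightarrow> bool" where
  "tree_graph G \<longleftrightarrow> finite_graph G \<and> connected_graph G \<and> (\<nexists>xs. gcycle G xs)"

definition joins :: "'a ugraph \<Rightarrow> 'a set \<Rightarrow> bool" where
  "joins G M \<longleftrightarrow> finite_graph G \<and> connected_graph G \<and> M \<subseteq> vertices G"

fun path_edges :: "'a list \<Rightarrow> 'a set list" where
  "path_edges (x # y # zs) = {x, y} # path_edges (y # zs)"
| "path_edges _ = []"

definition path_weight :: "('a set \<Rightarrow> real) \<Rightarrow> 'a list \<Rightarrow> real" where
  "path_weight \<omega> xs = (\<Sum>e\<leftarrow>path_edges xs. \<omega> e)"

(* A finite graph has finitely many paths, so Min is the true minimum whenever u and v are joined. *)
definition graph_dist :: "'a ugraph \<Rightarrow> ('a set \<Rightarrow> real) \<Rightarrow> 'a \<Rightarrow> 'a \<Rightarrow> real" where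
  "graph_dist G \<omega> u v = Min {path_weight \<omega> xs | xs. gpath G u xs v}"

definition graph_weight :: "'a ugraph \<Rightarrow> ('a set \<Rightarrow> real) \<Rightarrow> real" where
  "graph_weight G \<omega> = (\<Sum>e \<in> edges G. \<omega> e)"

definition filling :: "'a set \<Rightarrow> ('a \<Rightarrow> 'a \<Rightarrow> real) \<Rightarrow> 'a ugraph \<Rightarrow> ('a set \<Rightarrow> real) \<Rightarrow> bool" where
  "filling M \<rho> G \<omega> \<longleftrightarrow> joins G M \<and> (\<forall>e \<in> edges G. 0 \<le> \<omega> e) \<and>
     (\<forall>p \<in> M. \<forall>q \<in> M. \<rho> p q \<le> graph_dist G \<omega> p q)"

definition mpf :: "'a set \<Rightarrow> ('a \<Rightarrow> 'a \<Rightarrow> real) \<Rightarrow> 'a ugraph \<Rightarrow> real" where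
  "mpf M \<rho> G = Inf {graph_weight G \<omega> | \<omega>. filling M \<rho> G \<omega>}"

definition minimal_parametric_filling ::
    "'a set \<Rightarrow> ('a \<Rightarrow> 'a \<Rightarrow> real) \<Rightarrow> 'a ugraph \<Rightarrow> ('a set \<Rightarrow> real) \<Rightarrow> bool" where
  "minimal_parametric_filling M \<rho> G \<omega> \<longleftrightarrow>
     filling M \<rho> G \<omega> \<and> graph_weight G \<omega> = mpf M \<rho> G"

definition remove_edge :: "'a ugraph \<Rightarrow> 'a set \<Rightarrow> 'a ugraph" where
  "remove_edge G e = G\<lparr>edges := edges G - {e}\<rparr>"

(* Vertex sets of the connected components. *)
definition components :: "'a ugraph \<Rightarrow> 'a set set" where
  "components G = (\<lambda>u. {v. \<exists>xs. gpath G u xs v}) ` vertices G"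

definition edge_partition :: "'a ugraph \<Rightarrow> 'a set \<Rightarrow> 'a set \<Rightarrow> 'a set set" where
  "edge_partition G M e = (\<lambda>C. M \<inter> C) ` components (remove_edge G e)"

(* A permutation of M is a function on the whole type that is the identity outside M. *)
definition cyclic_order :: "'a set \<Rightarrow> ('a \<Rightarrow> 'a) \<Rightarrow> bool" where
  "cyclic_order M \<pi> \<longleftrightarrow> \<pi> permutes M \<and> cyclic_on \<pi> M"

definition tours :: "'a ugraph \<Rightarrow> 'a set \<Rightarrow> ('a \<Rightarrow> 'a) set" where
  "tours G M = {\<pi>. cyclic_order M \<pi> \<and>
     (\<forall>e \<in> edges G. \<forall>N \<in> edge_partition G M e. \<exists>!p. p \<in> N \<and> \<pi> p \<notin> N)}"

definition exact_tour ::
    "'a set \<Rightarrow> ('a \<Rightarrow> 'a \<Rightarrow> real) \<Rightarrow> 'a ugraph \<Rightarrow> ('a set \<Rightarrow> real) \<Rightarrow> ('a \<Rightarrow> 'a) \<Rightarrow> bool" where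
  "exact_tour M \<rho> G \<omega> \<pi> \<longleftrightarrow> \<pi> \<in> tours G M \<and> (\<forall>p \<in> M. \<rho> p (\<pi> p) = graph_dist G \<omega> p (\<pi> p))"

definition half_perimeter :: "'a set \<Rightarrow> ('a \<Rightarrow> 'a \<Rightarrow> real) \<Rightarrow> ('a \<Rightarrow> 'a) \<Rightarrow> real" where
  "half_perimeter M \<rho> \<pi> = (\<Sum>x \<in> M. \<rho> x (\<pi> x)) / 2"

end

theory Submission
  imports Defs
begin

text \<open>
  In a tree, a path from \<open>p\<close> to \<open>q\<close> runs through exactly those edges whose removal separates
  \<open>p\<close> from \<open>q\<close>, each of them once, so \<open>d\<^sub>\<omega>(p,q)\<close> is the total weight of these edges
  (\<open>graph_dist_tree\<close>). Removing an edge \<open>e\<close> splits the tree into two components, and a tour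
  \<open>\<sigma>\<close> steps out of each of them exactly once; hence \<open>e\<close> separates \<open>p\<close> from \<open>\<sigma> p\<close> for exactly
  two points \<open>p\<close> of \<open>M\<close> (\<open>card_separated_tour\<close>). Double counting gives
  \<open>\<Sum>\<^sub>p d\<^sub>\<omega>(p, \<sigma> p) = 2 \<omega>(G)\<close> for every tour \<open>\<sigma>\<close> and every weight \<open>\<omega>\<close> (\<open>sum_graph_dist_tour\<close>).

  If \<open>\<omega>\<close> is a filling, then \<open>\<rho> \<le> d\<^sub>\<omega>\<close> on \<open>M\<close>, so the half-perimeter of every tour is at most
  the weight of every filling, with equality exactly when \<open>\<rho>\<close> and \<open>d\<^sub>\<omega>\<close> agree along the tour.
  An exact tour therefore attains equality in this weak duality, which makes the filling minimal
  and the tour maximal.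
\<close>

section \<open>Connection by walks and by paths\<close>

text \<open>Existence of a walk. Walks may repeat vertices, so they can be concatenated freely, which
  paths cannot. Endpoints need not be vertices of \<open>G\<close>: every point is linked to itself.\<close>

definition linked :: "'a ugraph \<Rightarrow> 'a \<Rightarrow> 'a \<Rightarrow> bool" where
  "linked G = (\<lambda>x y. {x, y} \<in> edges G)\<^sup>*\<^sup>*"

lemma linked_refl: "linked G u u"
  by (simp add: linked_def)

lemma linked_trans: "linked G u v \<Longrightarrow> linked G v w \<Longrightarrow> linked G u w"
  unfolding linked_def by (rule rtranclp_trans)

lemma linked_edge: "{u, v} \<in> edges G \<Longrightarrow> linked G u v"
  unfolding linked_def by (rule r_into_rtranclp)

lemma linked_sym: "linked G u v \<Longrightarrow> linked G v u"
proof -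
  have "symp (\<lambda>x y. {x, y} \<in> edges G)"
    by (auto simp: symp_def insert_commute)
  then show "linked G u v \<Longrightarrow> linked G v u"
    unfolding linked_def by (metis symp_rtranclp sympD)
qed

lemma successively_edges_iff:
  "successively (\<lambda>a b. {a, b} \<in> E) xs \<longleftrightarrow> set (path_edges xs) \<subseteq> E"
  by (induction xs rule: path_edges.induct) auto

lemma path_edges_append:
  "path_edges (ys @ a # b # zs) = path_edges (ys @ [a]) @ {a, b} # path_edges (b # zs)"
proof (induction ys)
  case (Cons y ys)
  then show ?case by (cases ys) auto
qed simp

lemma path_edges_subset: "e \<in> set (path_edges xs) \<Longrightarrow> e \<subseteq> set xs"
  by (induction xs rule: path_edges.induct) auto

lemma distinct_path_edges: "distinct xs \<Longrightarrow> distinct (path_edges xs)"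
proof (induction xs rule: path_edges.induct)
  case (1 x y zs)
  then show ?case using path_edges_subset[of "{x, y}" "y # zs"] by auto
qed auto

lemma path_edges_split:
  assumes "e \<in> set (path_edges xs)"
  obtains ys a b zs where "e = {a, b}" "xs = ys @ a # b # zs"
  using assms
proof (induction xs arbitrary: thesis rule: path_edges.induct)
  case (1 x y zs)
  show ?case
  proof (cases "e = {x, y}")
    case True
    then show ?thesis using "1.prems"(1)[of x y "[]" zs] by simp
  next
    case False
    then have "e \<in> set (path_edges (y # zs))" using "1.prems"(2) by simp
    then obtain us a b vs where "e = {a, b}" "y # zs = us @ a # b # vs"
      using "1.IH" by blast
    then show ?thesis using "1.prems"(1)[of a b "x # us" vs] by simp
  qed
qed auto

lemma linked_path_edges:
  "xs \<noteq> [] \<Longrightarrow> set (path_edges xs) \<subseteq> edges G \<Longrightarrow> linked G (hd xs) (last xs)"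
proof (induction xs rule: path_edges.induct)
  case (1 x y zs)
  then show ?case using linked_trans[OF linked_edge[of x y G], of "last (y # zs)"] by simp
qed (auto simp: linked_refl)

text \<open>A walk is turned into a path by cutting it back to the first visit whenever a vertex is
  met again.\<close>

lemma gpath_of_linked:
  assumes G: "finite_graph G" and uv: "linked G u v" and u: "u \<in> vertices G"
  shows "\<exists>xs. gpath G u xs v"
  using uv unfolding linked_def
proof (induction rule: rtranclp_induct)
  case base
  have "gpath G u [u] u" using u by (simp add: gpath_def)
  then show ?case by blast
next
  case (step b c)
  then obtain xs where xs: "gpath G u xs b" by blast
  have c: "c \<in> vertices G" using step(2) G by (auto simp: finite_graph_def)
  show ?case
  proof (cases "c \<in> set xs")
    case True
    then obtain ys zs where split: "xs = ys @ c # zs" by (meson split_list)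
    then have app: "xs = (ys @ [c]) @ zs" by simp
    have "successively (\<lambda>a b. {a, b} \<in> edges G) (ys @ [c])"
      using xs unfolding app gpath_def successively_append_iff by blast
    moreover have "hd (ys @ [c]) = u"
      using xs unfolding split gpath_def by (cases ys) auto
    ultimately have "gpath G u (ys @ [c]) c"
      using xs unfolding split gpath_def by auto
    then show ?thesis by blast
  next
    case False
    then have "gpath G u (xs @ [c]) c"
      using xs c step(2) by (auto simp: gpath_def successively_append_iff)
    then show ?thesis by blast
  qed
qed

lemma gpath_iff_linked:
  assumes "finite_graph G" "u \<in> vertices G"
  shows "(\<exists>xs. gpath G u xs v) \<longleftrightarrow> linked G u v"
proof
  assume "\<exists>xs. gpath G u xs v"
  then show "linked G u v"
    using linked_path_edges by (fastforce simp: gpath_def successively_edges_iff)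
qed (rule gpath_of_linked[OF assms(1) _ assms(2)])

section \<open>Separating edges of a tree\<close>

text \<open>The edges whose removal disconnects \<open>p\<close> from \<open>q\<close>.\<close>

definition separating_edges :: "'a ugraph \<Rightarrow> 'a \<Rightarrow> 'a \<Rightarrow> 'a set set" where
  "separating_edges G p q = {e \<in> edges G. \<not> linked (remove_edge G e) p q}"

lemma finite_edges: "finite_graph G \<Longrightarrow> finite (edges G)"
  by (rule finite_subset[of _ "Pow (vertices G)"]) (auto simp: finite_graph_def)

lemma remove_edge_simps [simp]:
  "vertices (remove_edge G e) = vertices G" "edges (remove_edge G e) = edges G - {e}"
  by (simp_all add: remove_edge_def)

lemma finite_graph_remove_edge: "finite_graph G \<Longrightarrow> finite_graph (remove_edge G e)"
  by (simp add: finite_graph_def)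

text \<open>A path that joins the ends of an edge without using it closes up to a cycle.\<close>

lemma tree_edge_separates_ends:
  assumes G: "tree_graph G" and e: "{a, b} \<in> edges G"
  shows "\<not> linked (remove_edge G {a, b}) a b"
proof
  let ?H = "remove_edge G {a, b}"
  assume "linked ?H a b"
  moreover have fin: "finite_graph G" using G by (simp add: tree_graph_def)
  moreover have a: "a \<in> vertices G" and "card {a, b} = 2"
    using fin e by (auto simp: finite_graph_def)
  then have ab: "a \<noteq> b" by auto
  ultimately obtain xs where xs: "gpath ?H a xs b"
    using gpath_of_linked[of ?H a b] finite_graph_remove_edge[OF fin, of "{a, b}"] a by auto
  have "length xs \<ge> 3"
  proof (rule ccontr)
    assume "\<not> length xs \<ge> 3"
    with xs ab have "xs = [a, b]"
      by (auto simp: gpath_def neq_Nil_conv not_le numeral_3_eq_3 less_Suc_eq length_Suc_conv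
          split: if_splits)
    then show False using xs by (simp add: gpath_def)
  qed
  moreover have "successively (\<lambda>x y. {x, y} \<in> edges G) xs"
    using xs by (auto simp: gpath_def elim: successively_mono)
  moreover have "{last xs, hd xs} \<in> edges G"
    using xs e by (simp add: gpath_def insert_commute)
  ultimately have "gcycle G xs" using xs by (simp add: gcycle_def gpath_def)
  then show False using G by (auto simp: tree_graph_def)
qed

lemma path_edges_eq_separating_edges:
  assumes G: "tree_graph G" and xs: "gpath G p xs q"
  shows "set (path_edges xs) = separating_edges G p q"
proof (intro set_eqI iffI)
  fix e assume e: "e \<in> separating_edges G p q"
  show "e \<in> set (path_edges xs)"
  proof (rule ccontr)
    assume "e \<notin> set (path_edges xs)"
    then have "set (path_edges xs) \<subseteq> edges (remove_edge G e)"
      using xs by (auto simp: gpath_def successively_edges_iff)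
    then have "linked (remove_edge G e) p q"
      using xs linked_path_edges[of xs] by (auto simp: gpath_def)
    then show False using e by (simp add: separating_edges_def)
  qed
next
  fix e assume e: "e \<in> set (path_edges xs)"
  then obtain ys a b zs where ab: "e = {a, b}" and split: "xs = ys @ a # b # zs"
    by (rule path_edges_split)
  let ?H = "remove_edge G e"
  have E: "set (path_edges xs) \<subseteq> edges G"
    using xs by (simp add: gpath_def successively_edges_iff)
  have "distinct (path_edges xs)" using xs by (simp add: gpath_def distinct_path_edges)
  then have "set (path_edges (ys @ [a])) \<subseteq> edges ?H" "set (path_edges (b # zs)) \<subseteq> edges ?H"
    using E unfolding split path_edges_append ab by auto
  then have "linked ?H (hd (ys @ [a])) (last (ys @ [a]))"
    and "linked ?H (hd (b # zs)) (last (b # zs))"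
    by (intro linked_path_edges; simp)+
  moreover have "hd (ys @ [a]) = p" "last (b # zs) = q"
    using xs unfolding split gpath_def by (cases ys; auto)+
  ultimately have pa: "linked ?H p a" and bq: "linked ?H b q" by auto
  have "\<not> linked ?H a b"
    using tree_edge_separates_ends[OF G, of a b] E e ab by auto
  \<comment> \<open>A walk from \<open>p\<close> to \<open>q\<close> avoiding \<open>e\<close> would connect the two ends of \<open>e\<close>.\<close>
  then have "\<not> linked ?H p q"
    using pa bq linked_sym linked_trans by metis
  then show "e \<in> separating_edges G p q" using E e by (auto simp: separating_edges_def)
qed

lemma graph_dist_tree:
  assumes G: "tree_graph G" and p: "p \<in> vertices G" and q: "q \<in> vertices G"
  shows "graph_dist G \<omega> p q = sum \<omega> (separating_edges G p q)"
proof -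
  have "path_weight \<omega> xs = sum \<omega> (separating_edges G p q)" if "gpath G p xs q" for xs
  proof -
    have "distinct (path_edges xs)" using that by (simp add: gpath_def distinct_path_edges)
    then show ?thesis
      unfolding path_weight_def
      by (simp add: sum_list_distinct_conv_sum_set path_edges_eq_separating_edges[OF G that])
  qed
  moreover obtain xs where "gpath G p xs q"
    using G p q unfolding tree_graph_def connected_graph_def by blast
  ultimately have "{path_weight \<omega> xs | xs. gpath G p xs q} = {sum \<omega> (separating_edges G p q)}"
    by (auto intro!: exI[of _ xs])
  then show ?thesis by (simp add: graph_dist_def)
qed

lemma tree_remove_edge_two_sides:
  assumes G: "tree_graph G" and e: "{a, b} \<in> edges G" and v: "v \<in> vertices G"
  shows "linked (remove_edge G {a, b}) a v \<or> linked (remove_edge G {a, b}) b v"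
proof -
  let ?H = "remove_edge G {a, b}"
  have fin: "finite_graph G" and "a \<in> vertices G"
    using G e by (auto simp: tree_graph_def finite_graph_def)
  then have "linked G a v"
    using G v gpath_iff_linked[OF fin, of a v] by (auto simp: tree_graph_def connected_graph_def)
  then show ?thesis unfolding linked_def[of G]
  proof (induction rule: rtranclp_induct)
    case base
    then show ?case by (simp add: linked_refl)
  next
    case (step x y)
    show ?case
    proof (cases "{x, y} = {a, b}")
      case True
      then have "y = a \<or> y = b" by blast
      then show ?thesis by (auto simp: linked_refl)
    next
      case False
      then have "linked ?H x y" using step(2) by (intro linked_edge) simp
      then show ?thesis using step(3) linked_trans by metis
    qed
  qed
qed

section \<open>Double counting along a tour\<close>

lemma side_in_edge_partition:
  assumes "finite_graph G" "a \<in> vertices G"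
  shows "M \<inter> {v. linked (remove_edge G e) a v} \<in> edge_partition G M e"
proof -
  have "{v. linked (remove_edge G e) a v} = {v. \<exists>xs. gpath (remove_edge G e) a xs v}"
    using assms by (simp add: gpath_iff_linked finite_graph_remove_edge)
  then show ?thesis
    using assms(2) unfolding edge_partition_def components_def by auto
qed

lemma card_separated_tour:
  assumes G: "tree_graph G" and M: "M \<subseteq> vertices G" and \<sigma>: "\<sigma> \<in> tours G M"
    and e: "e \<in> edges G"
  shows "card {p \<in> M. e \<in> separating_edges G p (\<sigma> p)} = 2"
proof -
  have fin: "finite_graph G" using G by (simp add: tree_graph_def)
  then have "card e = 2" using e by (simp add: finite_graph_def)
  then obtain a b where ab: "e = {a, b}" "a \<noteq> b" by (meson card_2_iff)
  have V: "a \<in> vertices G" "b \<in> vertices G" using fin e ab by (auto simp: finite_graph_def)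
  let ?H = "remove_edge G e"
  define A where "A = M \<inter> {v. linked ?H a v}"
  define B where "B = M \<inter> {v. linked ?H b v}"
  have "M \<subseteq> A \<union> B"
    using tree_remove_edge_two_sides[OF G, of a b] e ab M by (auto simp: A_def B_def)
  then have MAB: "M = A \<union> B" by (auto simp: A_def B_def)
  have "\<not> linked ?H a b" using tree_edge_separates_ends[OF G, of a b] e ab by simp
  then have disj: "A \<inter> B = {}"
    by (auto simp: A_def B_def dest: linked_trans[OF _ linked_sym])
  have \<sigma>M: "\<sigma> p \<in> M" if "p \<in> M" for p
    using \<sigma> that permutes_in_image[of \<sigma> M] by (auto simp: tours_def cyclic_order_def)
  have "A \<in> edge_partition G M e" "B \<in> edge_partition G M e"
    unfolding A_def B_def using V by (auto intro: side_in_edge_partition[OF fin])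
  then have "\<exists>!p. p \<in> A \<and> \<sigma> p \<notin> A" "\<exists>!p. p \<in> B \<and> \<sigma> p \<notin> B"
    using \<sigma> e by (simp_all add: tours_def)
  then obtain p q where p: "{x. x \<in> A \<and> \<sigma> x \<notin> A} = {p}" and q: "{x. x \<in> B \<and> \<sigma> x \<notin> B} = {q}"
    by (auto simp: set_eq_iff elim!: ex1E)
  have sepA: "linked ?H x (\<sigma> x) \<longleftrightarrow> \<sigma> x \<in> A" if "x \<in> A" for x
    using that \<sigma>M[of x] unfolding A_def
    by (auto intro: linked_trans[of ?H a x] linked_trans[OF linked_sym, of ?H a])
  have sepB: "linked ?H x (\<sigma> x) \<longleftrightarrow> \<sigma> x \<in> B" if "x \<in> B" for x
    using that \<sigma>M[of x] unfolding B_def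
    by (auto intro: linked_trans[of ?H b x] linked_trans[OF linked_sym, of ?H b])
  have "{x \<in> M. e \<in> separating_edges G x (\<sigma> x)} =
      {x. x \<in> A \<and> \<sigma> x \<notin> A} \<union> {x. x \<in> B \<and> \<sigma> x \<notin> B}"
    using e MAB sepA sepB by (auto simp: separating_edges_def)
  also have "\<dots> = {p, q}" using p q by auto
  finally have "{x \<in> M. e \<in> separating_edges G x (\<sigma> x)} = {p, q}" .
  moreover have "p \<noteq> q" using p q disj by blast
  ultimately show ?thesis by simp
qed

lemma sum_graph_dist_tour:
  assumes finM: "finite M" and G: "tree_graph G" and M: "M \<subseteq> vertices G"
    and \<sigma>: "\<sigma> \<in> tours G M"
  shows "(\<Sum>p\<in>M. graph_dist G \<omega> p (\<sigma> p)) = 2 * graph_weight G \<omega>"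
proof -
  have finE: "finite (edges G)" using G by (simp add: tree_graph_def finite_edges)
  have \<sigma>M: "\<sigma> p \<in> M" if "p \<in> M" for p
    using \<sigma> that permutes_in_image[of \<sigma> M] by (auto simp: tours_def cyclic_order_def)
  have "(\<Sum>p\<in>M. graph_dist G \<omega> p (\<sigma> p)) =
      (\<Sum>p\<in>M. \<Sum>e | e \<in> edges G \<and> e \<in> separating_edges G p (\<sigma> p). \<omega> e)"
  proof (rule sum.cong[OF refl])
    fix p assume "p \<in> M"
    then have "graph_dist G \<omega> p (\<sigma> p) = sum \<omega> (separating_edges G p (\<sigma> p))"
      using G M \<sigma>M by (intro graph_dist_tree) auto
    also have "separating_edges G p (\<sigma> p) = {e. e \<in> edges G \<and> e \<in> separating_edges G p (\<sigma> p)}"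
      by (auto simp: separating_edges_def)
    finally show "graph_dist G \<omega> p (\<sigma> p) =
        (\<Sum>e | e \<in> edges G \<and> e \<in> separating_edges G p (\<sigma> p). \<omega> e)" .
  qed
  also have "\<dots> = (\<Sum>e\<in>edges G. \<Sum>p | p \<in> M \<and> e \<in> separating_edges G p (\<sigma> p). \<omega> e)"
    by (rule sum.swap_restrict[OF finM finE])
  also have "\<dots> = (\<Sum>e\<in>edges G. 2 * \<omega> e)"
    using card_separated_tour[OF G M \<sigma>] by (intro sum.cong) simp_all
  finally show ?thesis by (simp add: graph_weight_def sum_distrib_left)
qed

section \<open>Duality between fillings and tours\<close>

lemma tour_le_graph_dist:
  assumes "filling M \<rho> G \<omega>" "\<sigma> \<in> tours G M" "p \<in> M"
  shows "\<rho> p (\<sigma> p) \<le> graph_dist G \<omega> p (\<sigma> p)"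
proof -
  have "\<sigma> p \<in> M"
    using assms(2,3) permutes_in_image[of \<sigma> M] by (auto simp: tours_def cyclic_order_def)
  then show ?thesis using assms(1,3) by (simp add: filling_def)
qed

lemma half_perimeter_le_graph_weight:
  assumes "finite M" "tree_graph G" "filling M \<rho> G \<omega>" "\<sigma> \<in> tours G M"
  shows "half_perimeter M \<rho> \<sigma> \<le> graph_weight G \<omega>"
proof -
  have "(\<Sum>p\<in>M. \<rho> p (\<sigma> p)) \<le> (\<Sum>p\<in>M. graph_dist G \<omega> p (\<sigma> p))"
    using tour_le_graph_dist[OF assms(3,4)] by (rule sum_mono)
  also have "\<dots> = 2 * graph_weight G \<omega>"
    using assms by (intro sum_graph_dist_tour) (auto simp: filling_def joins_def)
  finally show ?thesis by (simp add: half_perimeter_def)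
qed

lemma exact_tour_iff:
  assumes finM: "finite M" and G: "tree_graph G" and fill: "filling M \<rho> G \<omega>"
    and \<sigma>: "\<sigma> \<in> tours G M"
  shows "exact_tour M \<rho> G \<omega> \<sigma> \<longleftrightarrow> graph_weight G \<omega> = half_perimeter M \<rho> \<sigma>"
proof -
  have sum: "(\<Sum>p\<in>M. graph_dist G \<omega> p (\<sigma> p)) = 2 * graph_weight G \<omega>"
    using finM G \<sigma> fill by (intro sum_graph_dist_tour) (auto simp: filling_def joins_def)
  have "(\<Sum>p\<in>M. graph_dist G \<omega> p (\<sigma> p) - \<rho> p (\<sigma> p)) = 0 \<longleftrightarrow>
      (\<forall>p\<in>M. graph_dist G \<omega> p (\<sigma> p) - \<rho> p (\<sigma> p) = 0)"
    using tour_le_graph_dist[OF fill \<sigma>] by (intro sum_nonneg_eq_0_iff[OF finM]) simp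
  moreover have "\<dots> \<longleftrightarrow> exact_tour M \<rho> G \<omega> \<sigma>"
    using \<sigma> by (auto simp: exact_tour_def)
  moreover have "(\<Sum>p\<in>M. graph_dist G \<omega> p (\<sigma> p) - \<rho> p (\<sigma> p)) = 0 \<longleftrightarrow>
      graph_weight G \<omega> = half_perimeter M \<rho> \<sigma>"
    unfolding sum_subtractf sum half_perimeter_def by linarith
  ultimately show ?thesis by blast
qed

lemma finite_tours: "finite M \<Longrightarrow> finite (tours G M)"
  by (rule finite_subset[OF _ finite_permutations[of M]])
    (auto simp: tours_def cyclic_order_def)

theorem mainTheorem8:
  fixes M :: "'a set" and \<rho> :: "'a \<Rightarrow> 'a \<Rightarrow> real"
    and G :: "'a ugraph" and \<omega> :: "'a set \<Rightarrow> real" and \<pi> :: "'a \<Rightarrow> 'a"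
  assumes "finite M" and "pseudo_metric_space M \<rho>"
    and "tree_graph G"
    and "filling M \<rho> G \<omega>"
    and "\<forall>v \<in> vertices G. degree G v \<in> {1, 2} \<longrightarrow> v \<in> M"
    and "\<pi> \<in> tours G M"
  shows "(exact_tour M \<rho> G \<omega> \<pi> \<longleftrightarrow> graph_weight G \<omega> = half_perimeter M \<rho> \<pi>) \<and>
    (exact_tour M \<rho> G \<omega> \<pi> \<longrightarrow>
       minimal_parametric_filling M \<rho> G \<omega> \<and>
       mpf M \<rho> G = half_perimeter M \<rho> \<pi> \<and>
       half_perimeter M \<rho> \<pi> = Max (half_perimeter M \<rho> ` tours G M))"
proof -
  note iff = exact_tour_iff[OF assms(1,3,4,6)]
  have "minimal_parametric_filling M \<rho> G \<omega> \<and> mpf M \<rho> G = half_perimeter M \<rho> \<pi> \<and>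
      half_perimeter M \<rho> \<pi> = Max (half_perimeter M \<rho> ` tours G M)"
    if "exact_tour M \<rho> G \<omega> \<pi>"
  proof -
    have w: "graph_weight G \<omega> = half_perimeter M \<rho> \<pi>" using iff that by simp
    have "mpf M \<rho> G = graph_weight G \<omega>"
      unfolding mpf_def
    proof (rule cInf_eq_minimum)
      show "graph_weight G \<omega> \<in> {graph_weight G \<omega>' | \<omega>'. filling M \<rho> G \<omega>'}"
        using assms(4) by blast
      show "graph_weight G \<omega> \<le> x" if "x \<in> {graph_weight G \<omega>' | \<omega>'. filling M \<rho> G \<omega>'}" for x
        using that half_perimeter_le_graph_weight[OF assms(1,3) _ assms(6)] w by auto
    qed
    moreover have "Max (half_perimeter M \<rho> ` tours G M) = half_perimeter M \<rho> \<pi>"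
      using half_perimeter_le_graph_weight[OF assms(1,3,4)] w assms(6) finite_tours[OF assms(1), of G]
      by (intro Max_eqI) auto
    ultimately show ?thesis
      using w assms(4) by (simp add: minimal_parametric_filling_def)
  qed
  then show ?thesis using iff by blast
qed

end
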